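(* Let $B$ be a skew brace and let $x_1,\dots,x_n\in B$ be $\theta_f$-elements of finite additive order (i.e. of finite order in $(B,+)$). Then the strong left ideal of $B$ generated by $x_1,\dots,x_n$ is finite.
   Context: A skew brace is a triple $(B,+,\circ)$ where $(B,+)$ and $(B,\circ)$ are (not necessarily abelian) groups with $a\circ(b+c)=a\circ b-a+a\circ c$ for all $a,b,c\in B$, where $-a$ is the inverse of $a$ in $(B,+)$ and $\circ$ takes precedence over $+$. Put $\lambda_a(b)=-a+a\circ b$ (an automorphism of $(B,+)$ in $b$) and $\theta_{(a,b)}(c)=a+\lambda_b(c)-a$ for $a,b,c\in B$. An element $x\in B$ is a $\theta_f$-element if $[x]_\theta=\{\theta_{(a,b)}(x): a,b\in B\}$ is finite. A strong left ideal of $B$ is a normal subgroup $L$ of $(B,+)$ with $\lambda_b(L)=L$ for all $b\in B$. The strong left ideal generated by a subset is the smallest strong left ideal containing it. *)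

theory Defs
  imports "HOL-Algebra.Algebra"
begin

text \<open>
  A skew brace is carried by two group structures \<open>A\<close> (the additive group, written
  multiplicatively by the library and not assumed abelian) and \<open>C\<close> (the circle group) with
  the same carrier.
\<close>

locale skew_brace = add: group A + circ: group C
  for A :: "('a, 'm) monoid_scheme" and C :: "('a, 'n) monoid_scheme" +
  assumes carrier_eq: "carrier C = carrier A"
    and brace: "\<lbrakk> a \<in> carrier A; b \<in> carrier A; c \<in> carrier A \<rbrakk> \<Longrightarrow>
      a \<otimes>\<^bsub>C\<^esub> (b \<otimes>\<^bsub>A\<^esub> c) =
      (a \<otimes>\<^bsub>C\<^esub> b) \<otimes>\<^bsub>A\<^esub> inv\<^bsub>A\<^esub> a \<otimes>\<^bsub>A\<^esub> (a \<otimes>\<^bsub>C\<^esub> c)"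
begin

definition lam :: "'a \<Rightarrow> 'a \<Rightarrow> 'a" where
  "lam a b = inv\<^bsub>A\<^esub> a \<otimes>\<^bsub>A\<^esub> (a \<otimes>\<^bsub>C\<^esub> b)"

definition theta :: "'a \<times> 'a \<Rightarrow> 'a \<Rightarrow> 'a" where
  "theta = (\<lambda>(a, b) c. a \<otimes>\<^bsub>A\<^esub> lam b c \<otimes>\<^bsub>A\<^esub> inv\<^bsub>A\<^esub> a)"

definition theta_class :: "'a \<Rightarrow> 'a set" where
  "theta_class x = {theta (a, b) x | a b. a \<in> carrier A \<and> b \<in> carrier A}"

definition theta_f_element :: "'a \<Rightarrow> bool" where
  "theta_f_element x \<longleftrightarrow> x \<in> carrier A \<and> finite (theta_class x)"

definition strong_left_ideal :: "'a set \<Rightarrow> bool" where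
  "strong_left_ideal L \<longleftrightarrow> L \<lhd> A \<and> (\<forall>b \<in> carrier A. lam b ` L = L)"

text \<open>
  For \<open>S \<subseteq> carrier A\<close> this intersection is the smallest strong left ideal containing \<open>S\<close>, as
  the lemmas below show; for other \<open>S\<close> it is an intersection over the empty family.
\<close>

definition strong_left_ideal_generated :: "'a set \<Rightarrow> 'a set" where
  "strong_left_ideal_generated S = \<Inter>{L. strong_left_ideal L \<and> S \<subseteq> L}"

lemma lam_closed: "a \<in> carrier A \<Longrightarrow> b \<in> carrier A \<Longrightarrow> lam a b \<in> carrier A"
  unfolding lam_def using carrier_eq circ.m_closed by simp

lemma inj_on_lam:
  assumes "a \<in> carrier A"
  shows "inj_on (lam a) (carrier A)"
proof (rule inj_onI)
  fix b c assume bc: "b \<in> carrier A" "c \<in> carrier A" and eq: "lam a b = lam a c"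
  have "a \<otimes>\<^bsub>C\<^esub> b \<in> carrier A" "a \<otimes>\<^bsub>C\<^esub> c \<in> carrier A"
    using assms bc carrier_eq circ.m_closed by simp_all
  then have "a \<otimes>\<^bsub>C\<^esub> b = a \<otimes>\<^bsub>C\<^esub> c"
    using eq assms unfolding lam_def by simp
  then show "b = c"
    using assms bc carrier_eq by simp
qed

lemma lam_surj:
  assumes "a \<in> carrier A" "c \<in> carrier A"
  shows "\<exists>b \<in> carrier A. lam a b = c"
proof
  let ?d = "a \<otimes>\<^bsub>A\<^esub> c"
  have d: "?d \<in> carrier A" using assms by simp
  show "inv\<^bsub>C\<^esub> a \<otimes>\<^bsub>C\<^esub> ?d \<in> carrier A"
    using assms d carrier_eq circ.m_closed circ.inv_closed by simp
  have "a \<otimes>\<^bsub>C\<^esub> (inv\<^bsub>C\<^esub> a \<otimes>\<^bsub>C\<^esub> ?d) = ?d"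
    using assms(1) d circ.inv_closed[of a] circ.m_assoc[of a "inv\<^bsub>C\<^esub> a" ?d]
    unfolding carrier_eq[symmetric] by simp
  then show "lam a (inv\<^bsub>C\<^esub> a \<otimes>\<^bsub>C\<^esub> ?d) = c"
    unfolding lam_def using assms by (simp add: add.m_assoc[symmetric])
qed

lemma strong_left_ideal_carrier: "strong_left_ideal (carrier A)"
  unfolding strong_left_ideal_def
proof (intro conjI ballI)
  show "carrier A \<lhd> A"
    by (simp add: add.normal_inv_iff add.subgroup_self)
next
  fix b assume b: "b \<in> carrier A"
  show "lam b ` carrier A = carrier A"
  proof
    show "lam b ` carrier A \<subseteq> carrier A"
      using lam_closed[OF b] by (rule image_subsetI)
    show "carrier A \<subseteq> lam b ` carrier A"
      using lam_surj[OF b] by (fastforce intro: rev_image_eqI)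
  qed
qed

lemma strong_left_ideal_subset: "strong_left_ideal L \<Longrightarrow> L \<subseteq> carrier A"
  unfolding strong_left_ideal_def using subgroup.subset[OF add.normal_invE(1)] by simp

lemma strong_left_ideal_strong_left_ideal_generated:
  assumes S: "S \<subseteq> carrier A"
  shows "strong_left_ideal (strong_left_ideal_generated S)"
proof -
  let ?F = "{L. strong_left_ideal L \<and> S \<subseteq> L}"
  have ne: "carrier A \<in> ?F" using S strong_left_ideal_carrier by simp
  have mem: "subgroup L A" "\<And>g h. g \<in> carrier A \<Longrightarrow> h \<in> L \<Longrightarrow> g \<otimes>\<^bsub>A\<^esub> h \<otimes>\<^bsub>A\<^esub> inv\<^bsub>A\<^esub> g \<in> L"
    if "L \<in> ?F" for L
    using add.normal_invE[of L] that unfolding strong_left_ideal_def by simp_all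
  have "subgroup (\<Inter>?F) A"
    using ne mem(1) by (intro add.subgroups_Inter) blast+
  then have "\<Inter>?F \<lhd> A"
    using mem(2) by (intro add.normal_invI) blast+
  moreover have "lam b ` (\<Inter>?F) = \<Inter>?F" if b: "b \<in> carrier A" for b
  proof -
    have "lam b ` (\<Inter>L\<in>?F. L) = (\<Inter>L\<in>?F. lam b ` L)"
      by (rule image_INT[OF inj_on_lam[OF b] _ ne]) (auto dest: strong_left_ideal_subset)
    also have "\<dots> = (\<Inter>L\<in>?F. L)"
      using b by (intro INF_cong) (auto simp: strong_left_ideal_def)
    finally show ?thesis by simp
  qed
  ultimately show ?thesis
    unfolding strong_left_ideal_def[of "strong_left_ideal_generated S"]
    unfolding strong_left_ideal_generated_def by blast
qed

lemma strong_left_ideal_generated_superset: "S \<subseteq> strong_left_ideal_generated S"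
  unfolding strong_left_ideal_generated_def by blast

lemma strong_left_ideal_generated_least:
  "strong_left_ideal L \<Longrightarrow> S \<subseteq> L \<Longrightarrow> strong_left_ideal_generated S \<subseteq> L"
  unfolding strong_left_ideal_generated_def by blast

end

end

theory Submission
  imports Defs
begin

text \<open>
  The theorem is an instance of Dietzmann's lemma: in any group, a finite set of elements of
  finite order which is stable under conjugation generates a finite subgroup. Here the set is the
  union \<open>T\<close> of the classes \<open>theta_class (x i)\<close>. It is finite by hypothesis, and its elements have
  finite order because every \<open>theta p\<close> is an additive endomorphism. Since \<open>lam\<close> is an
  action of the circle group by additive automorphisms, \<open>T\<close> is stable under conjugation and under
  every \<open>lam b\<close>. Hence the additive subgroup generated by \<open>T\<close> is already a strong left ideal, it
  contains every \<open>x i\<close>, and it is finite by Dietzmann's lemma.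

  For Dietzmann's lemma itself, every element of the subgroup is the product of a word over \<open>T\<close>.
  In a long word some letter \<open>y\<close> occurs at least \<open>ord y\<close> times; these occurrences can be moved to
  the front at the cost of conjugating other letters, which remain in \<open>T\<close>, and then they
  cancel. So words of bounded length suffice, and there are finitely many of them.
\<close>

section \<open>Dietzmann's lemma\<close>

context group
begin

lemma foldr_mult_append:
  assumes "set u \<subseteq> carrier G" "set v \<subseteq> carrier G"
  shows "foldr (\<otimes>) (u @ v) \<one> = foldr (\<otimes>) u \<one> \<otimes> foldr (\<otimes>) v \<one>"
  using assms by (induction u) (simp_all add: m_assoc)

lemma foldr_mult_replicate:
  assumes "y \<in> carrier G"
  shows "foldr (\<otimes>) (replicate k y) \<one> = y [^] k"
proof (induction k)
  case (Suc k)
  then show ?case using nat_pow_Suc2[OF assms] by simp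
qed simp

text \<open>
  Inverses are not needed to write the elements of the generated subgroup, because the inverse of
  an element of finite order is one of its powers with nonnegative exponent.
\<close>

lemma generate_torsion_eq_words:
  assumes T: "T \<subseteq> carrier G" and tors: "\<And>y. y \<in> T \<Longrightarrow> ord y \<noteq> 0"
    and "h \<in> generate G T"
  shows "\<exists>w. set w \<subseteq> T \<and> foldr (\<otimes>) w \<one> = h"
  using assms(3)
proof (induction rule: generate.induct)
  case one
  show ?case by (rule exI[of _ "[]"]) simp
next
  case (incl h)
  then show ?case using T by (intro exI[of _ "[h]"]) auto
next
  case (inv h)
  have h: "h \<in> carrier G" using inv T by blast
  have "h \<otimes> h [^] (ord h - 1) = h [^] Suc (ord h - 1)"
    using nat_pow_Suc2[OF h] by simp
  also have "\<dots> = \<one>" using tors[OF inv] pow_ord_eq_1[OF h] by simp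
  finally have "inv h = h [^] (ord h - 1)"
    using h by (metis inv_solve_left m_closed nat_pow_closed one_closed r_one inv_closed)
  then show ?case
    using inv by (intro exI[of _ "replicate (ord h - 1) h"])
      (auto simp: foldr_mult_replicate[OF h] simp del: foldr_replicate)
next
  case (eng h1 h2)
  then obtain u v where "set u \<subseteq> T" "foldr (\<otimes>) u \<one> = h1" "set v \<subseteq> T" "foldr (\<otimes>) v \<one> = h2"
    by blast
  then show ?case using T foldr_mult_append[of u v]
    by (intro exI[of _ "u @ v"]) auto
qed

text \<open>
  Moving a block of \<open>k\<close> letters \<open>y\<close> to the left past \<open>z\<close> replaces \<open>z\<close> by a conjugate, as
  \<open>z y\<^sup>k = y\<^sup>k (y\<^sup>-\<^sup>k z y\<^sup>k)\<close>, and the conjugate is again a letter.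
\<close>

lemma collect_letter:
  assumes T: "T \<subseteq> carrier G"
    and conj: "\<And>g y. g \<in> carrier G \<Longrightarrow> y \<in> T \<Longrightarrow> g \<otimes> y \<otimes> inv g \<in> T"
    and y: "y \<in> carrier G"
    and "set w \<subseteq> T" "k \<le> count_list w y"
  shows "\<exists>w'. set w' \<subseteq> T \<and> length w = length w' + k \<and>
    foldr (\<otimes>) w \<one> = y [^] k \<otimes> foldr (\<otimes>) w' \<one>"
  using assms(4,5)
proof (induction w arbitrary: k)
  case Nil
  then show ?case by (intro exI[of _ "[]"]) simp
next
  case (Cons z v)
  have z: "z \<in> T" "z \<in> carrier G" and v: "set v \<subseteq> T" using Cons.prems T by auto
  show ?case
  proof (cases "z = y \<and> k > 0")
    case True
    then obtain j where j: "k = Suc j" using gr0_conv_Suc by blast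
    obtain w' where w': "set w' \<subseteq> T" "length v = length w' + j"
        "foldr (\<otimes>) v \<one> = y [^] j \<otimes> foldr (\<otimes>) w' \<one>"
      using Cons.IH[OF v, of j] Cons.prems True j by auto
    have "foldr (\<otimes>) w' \<one> \<in> carrier G" using w'(1) T by (intro multlist_closed) blast
    then have "foldr (\<otimes>) (z # v) \<one> = y [^] k \<otimes> foldr (\<otimes>) w' \<one>"
      using w'(3) True y nat_pow_Suc2[OF y, of j] by (simp add: j m_assoc del: nat_pow_Suc)
    then show ?thesis using w' j by auto
  next
    case False
    then have "k \<le> count_list v y" using Cons.prems by (auto split: if_splits)
    then obtain w' where w': "set w' \<subseteq> T" "length v = length w' + k"
        "foldr (\<otimes>) v \<one> = y [^] k \<otimes> foldr (\<otimes>) w' \<one>"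
      using Cons.IH[OF v] by blast
    define p z' where "p = y [^] k" and "z' = inv p \<otimes> z \<otimes> p"
    have p: "p \<in> carrier G" using y by (simp add: p_def)
    have z': "z' \<in> T" using conj[of "inv p" z] z p by (simp add: z'_def)
    have P: "foldr (\<otimes>) w' \<one> \<in> carrier G" using w'(1) T by (intro multlist_closed) blast
    have "p \<otimes> z' = z \<otimes> p"
      using p z by (simp add: z'_def m_assoc[symmetric])
    then have "z \<otimes> (p \<otimes> foldr (\<otimes>) w' \<one>) = p \<otimes> (z' \<otimes> foldr (\<otimes>) w' \<one>)"
      using p z P z' T by (metis m_assoc subsetD)
    then show ?thesis using w' z'
      by (intro exI[of _ "z' # w'"]) (simp add: p_def)
  qed
qed

text \<open>
  A word longer than \<open>\<Sum>y\<in>T. ord y\<close> contains, by the pigeonhole principle, some letter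
  \<open>y\<close> at least \<open>ord y\<close> times. Collecting exactly \<open>ord y\<close> of these produces a factor \<open>\<one>\<close>, so the
  word can be shortened.
\<close>

lemma bounded_word:
  assumes T: "T \<subseteq> carrier G" and fin: "finite T" and tors: "\<And>y. y \<in> T \<Longrightarrow> ord y \<noteq> 0"
    and conj: "\<And>g y. g \<in> carrier G \<Longrightarrow> y \<in> T \<Longrightarrow> g \<otimes> y \<otimes> inv g \<in> T"
    and "set w \<subseteq> T"
  shows "\<exists>w'. set w' \<subseteq> T \<and> length w' \<le> (\<Sum>y\<in>T. ord y) \<and> foldr (\<otimes>) w' \<one> = foldr (\<otimes>) w \<one>"
  using assms(5)
proof (induction w rule: length_induct)
  case (1 w)
  show ?case
  proof (cases "length w \<le> (\<Sum>y\<in>T. ord y)")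
    case False
    have "\<exists>y\<in>T. ord y \<le> count_list w y"
    proof (rule ccontr)
      assume "\<not> ?thesis"
      then have "sum (count_list w) T \<le> (\<Sum>y\<in>T. ord y)" by (intro sum_mono) auto
      then show False using False sum_count_set[OF 1(2) fin] by simp
    qed
    then obtain y where y: "y \<in> T" "ord y \<le> count_list w y" by blast
    then have yc: "y \<in> carrier G" using T by blast
    obtain v where v: "set v \<subseteq> T" "length w = length v + ord y"
        "foldr (\<otimes>) w \<one> = y [^] ord y \<otimes> foldr (\<otimes>) v \<one>"
      using collect_letter[OF T conj yc 1(2) y(2)] by blast
    have "foldr (\<otimes>) v \<one> \<in> carrier G" using v(1) T by (intro multlist_closed) blast
    then have "foldr (\<otimes>) w \<one> = foldr (\<otimes>) v \<one>"
      using v(3) pow_ord_eq_1[OF yc] by simp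
    moreover have "length v < length w" using v(2) tors[OF y(1)] by simp
    ultimately show ?thesis using 1(1) v(1) by auto
  qed (use 1(2) in blast)
qed

theorem Dietzmann:
  assumes T: "T \<subseteq> carrier G" and fin: "finite T" and tors: "\<And>y. y \<in> T \<Longrightarrow> ord y \<noteq> 0"
    and conj: "\<And>g y. g \<in> carrier G \<Longrightarrow> y \<in> T \<Longrightarrow> g \<otimes> y \<otimes> inv g \<in> T"
  shows "finite (generate G T)"
proof (rule finite_subset)
  let ?W = "{w. set w \<subseteq> T \<and> length w \<le> (\<Sum>y\<in>T. ord y)}"
  show "finite ((\<lambda>w. foldr (\<otimes>) w \<one>) ` ?W)"
    using finite_lists_length_le[OF fin] by blast
  show "generate G T \<subseteq> (\<lambda>w. foldr (\<otimes>) w \<one>) ` ?W"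
  proof
    fix h assume "h \<in> generate G T"
    then obtain w where w: "set w \<subseteq> T" "foldr (\<otimes>) w \<one> = h"
      using generate_torsion_eq_words[OF T tors] by blast
    obtain w' where "w' \<in> ?W" "foldr (\<otimes>) w' \<one> = h"
      using bounded_word[OF T fin tors conj w(1)] w(2) by blast
    then show "h \<in> (\<lambda>w. foldr (\<otimes>) w \<one>) ` ?W" by blast
  qed
qed

end

section \<open>The lambda action and theta classes\<close>

context skew_brace
begin

lemma circ_closed: "a \<in> carrier A \<Longrightarrow> b \<in> carrier A \<Longrightarrow> a \<otimes>\<^bsub>C\<^esub> b \<in> carrier A"
  using circ.m_closed carrier_eq by simp

lemma circ_eq_lam:
  assumes "a \<in> carrier A" "b \<in> carrier A"
  shows "a \<otimes>\<^bsub>C\<^esub> b = a \<otimes>\<^bsub>A\<^esub> lam a b"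
  using assms circ_closed by (simp add: lam_def add.m_assoc[symmetric])

lemma lam_add:
  assumes "a \<in> carrier A" "b \<in> carrier A" "c \<in> carrier A"
  shows "lam a (b \<otimes>\<^bsub>A\<^esub> c) = lam a b \<otimes>\<^bsub>A\<^esub> lam a c"
  using assms circ_closed by (simp add: lam_def brace add.m_assoc)

lemma group_hom_lam:
  assumes "a \<in> carrier A"
  shows "group_hom A A (lam a)"
  using assms lam_closed lam_add
  by (unfold_locales) (auto simp: hom_def)

lemma lam_circ:
  assumes a: "a \<in> carrier A" and b: "b \<in> carrier A" and c: "c \<in> carrier A"
  shows "lam (a \<otimes>\<^bsub>C\<^esub> b) c = lam a (lam b c)"
proof -
  have "(a \<otimes>\<^bsub>C\<^esub> b) \<otimes>\<^bsub>C\<^esub> c = a \<otimes>\<^bsub>C\<^esub> (b \<otimes>\<^bsub>A\<^esub> lam b c)"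
    using assms carrier_eq circ.m_assoc circ_eq_lam by simp
  also have "\<dots> = (a \<otimes>\<^bsub>C\<^esub> b) \<otimes>\<^bsub>A\<^esub> lam a (lam b c)"
    using assms brace lam_closed circ_closed by (simp add: lam_def add.m_assoc)
  finally show ?thesis
    using assms circ_closed lam_closed unfolding lam_def[of "a \<otimes>\<^bsub>C\<^esub> b"]
    by (simp add: add.m_assoc[symmetric])
qed

text \<open>The brace identity at \<open>a = b = c = \<one>\<^bsub>C\<^esub>\<close> makes \<open>\<one>\<^bsub>C\<^esub>\<close> additively idempotent.\<close>

lemma one_circ: "\<one>\<^bsub>C\<^esub> = \<one>\<^bsub>A\<^esub>"
proof -
  have e: "\<one>\<^bsub>C\<^esub> \<in> carrier A" using circ.one_closed carrier_eq by simp
  have "\<one>\<^bsub>C\<^esub> \<otimes>\<^bsub>A\<^esub> \<one>\<^bsub>C\<^esub> = \<one>\<^bsub>C\<^esub>"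
    using brace[OF e e e] e carrier_eq by simp
  then show ?thesis using e by simp
qed

lemma lam_one:
  assumes "c \<in> carrier A"
  shows "lam \<one>\<^bsub>A\<^esub> c = c"
proof -
  have "\<one>\<^bsub>A\<^esub> \<otimes>\<^bsub>C\<^esub> c = c"
    using assms carrier_eq circ.l_one[of c] one_circ by simp
  then show ?thesis using assms by (simp add: lam_def)
qed

lemma theta_closed:
  "a \<in> carrier A \<Longrightarrow> b \<in> carrier A \<Longrightarrow> c \<in> carrier A \<Longrightarrow> theta (a, b) c \<in> carrier A"
  by (simp add: theta_def lam_closed)

lemma group_hom_theta:
  assumes a: "a \<in> carrier A" and b: "b \<in> carrier A"
  shows "group_hom A A (theta (a, b))"
proof -
  have "theta (a, b) (c \<otimes>\<^bsub>A\<^esub> d) = theta (a, b) c \<otimes>\<^bsub>A\<^esub> theta (a, b) d"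
    if "c \<in> carrier A" "d \<in> carrier A" for c d
  proof -
    have "inv\<^bsub>A\<^esub> a \<otimes>\<^bsub>A\<^esub> (a \<otimes>\<^bsub>A\<^esub> e) = e" if "e \<in> carrier A" for e
      using a that by (simp add: add.m_assoc[symmetric])
    then show ?thesis
      using assms that by (simp add: theta_def lam_add lam_closed add.m_assoc)
  qed
  then show ?thesis
    using theta_closed[OF a b] by unfold_locales (auto simp: hom_def)
qed

lemma theta_classI: "a \<in> carrier A \<Longrightarrow> b \<in> carrier A \<Longrightarrow> theta (a, b) x \<in> theta_class x"
  by (auto simp: theta_class_def)

lemma self_in_theta_class:
  assumes "x \<in> carrier A"
  shows "x \<in> theta_class x"
proof -
  have "theta (\<one>\<^bsub>A\<^esub>, \<one>\<^bsub>A\<^esub>) x = x" using assms by (simp add: theta_def lam_one)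
  then show ?thesis using theta_classI add.one_closed by metis
qed

lemma theta_class_closed: "x \<in> carrier A \<Longrightarrow> theta_class x \<subseteq> carrier A"
  using theta_closed by (auto simp: theta_class_def)

lemma theta_class_conj:
  assumes "x \<in> carrier A" "g \<in> carrier A" "y \<in> theta_class x"
  shows "g \<otimes>\<^bsub>A\<^esub> y \<otimes>\<^bsub>A\<^esub> inv\<^bsub>A\<^esub> g \<in> theta_class x"
proof -
  obtain a b where ab: "a \<in> carrier A" "b \<in> carrier A" "y = theta (a, b) x"
    using assms by (auto simp: theta_class_def)
  have "g \<otimes>\<^bsub>A\<^esub> y \<otimes>\<^bsub>A\<^esub> inv\<^bsub>A\<^esub> g = theta (g \<otimes>\<^bsub>A\<^esub> a, b) x"
    using ab assms lam_closed by (simp add: theta_def add.m_assoc add.inv_mult_group)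
  then show ?thesis using ab assms theta_classI by simp
qed

lemma theta_class_lam:
  assumes "x \<in> carrier A" "g \<in> carrier A" "y \<in> theta_class x"
  shows "lam g y \<in> theta_class x"
proof -
  interpret lg: group_hom A A "lam g" by (rule group_hom_lam[OF assms(2)])
  obtain a b where ab: "a \<in> carrier A" "b \<in> carrier A" "y = theta (a, b) x"
    using assms by (auto simp: theta_class_def)
  have "lam g y = theta (lam g a, g \<otimes>\<^bsub>C\<^esub> b) x"
    using ab assms lam_closed by (simp add: theta_def lam_circ)
  then show ?thesis using ab assms lam_closed circ_closed theta_classI by simp
qed

lemma theta_class_ord:
  assumes x: "x \<in> carrier A" and ord: "add.ord x \<noteq> 0" and y: "y \<in> theta_class x"
  shows "add.ord y \<noteq> 0"
proof -
  obtain a b where ab: "a \<in> carrier A" "b \<in> carrier A" "y = theta (a, b) x"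
    using y by (auto simp: theta_class_def)
  interpret t: group_hom A A "theta (a, b)" by (rule group_hom_theta[OF ab(1,2)])
  have "y [^]\<^bsub>A\<^esub> add.ord x = theta (a, b) (x [^]\<^bsub>A\<^esub> add.ord x)"
    using ab t.hom_nat_pow[OF x] by simp
  also have "\<dots> = \<one>\<^bsub>A\<^esub>" by (simp add: add.pow_ord_eq_1[OF x])
  finally have "add.ord y dvd add.ord x"
    using add.pow_eq_id theta_class_closed[OF x] y by blast
  then show ?thesis using ord by auto
qed

section \<open>Strong left ideals generated by stable sets\<close>

text \<open>
  An additive automorphism that permutes the generators maps the generated subgroup onto itself.
  Finiteness of \<open>T\<close> upgrades \<open>lam b ` T \<subseteq> T\<close> to equality.
\<close>

lemma strong_left_ideal_generate:
  assumes T: "T \<subseteq> carrier A" and fin: "finite T"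
    and conj: "\<And>g y. g \<in> carrier A \<Longrightarrow> y \<in> T \<Longrightarrow> g \<otimes>\<^bsub>A\<^esub> y \<otimes>\<^bsub>A\<^esub> inv\<^bsub>A\<^esub> g \<in> T"
    and lam: "\<And>g y. g \<in> carrier A \<Longrightarrow> y \<in> T \<Longrightarrow> lam g y \<in> T"
  shows "strong_left_ideal (generate A T)"
  unfolding strong_left_ideal_def
proof (intro conjI ballI)
  show "generate A T \<lhd> A" using add.normal_generateI[OF T] conj by blast
next
  fix b assume b: "b \<in> carrier A"
  interpret lb: group_hom A A "lam b" by (rule group_hom_lam[OF b])
  have "lam b ` T = T"
    using inj_on_subset[OF inj_on_lam[OF b] T] lam[OF b] by (intro endo_inj_surj[OF fin]) auto
  then show "lam b ` generate A T = generate A T"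
    using lb.generate_img[OF T] by simp
qed

theorem finite_strong_left_ideal_generated:
  assumes fin: "finite S" and tf: "\<And>s. s \<in> S \<Longrightarrow> theta_f_element s"
    and ord: "\<And>s. s \<in> S \<Longrightarrow> add.ord s \<noteq> 0"
  shows "finite (strong_left_ideal_generated S)"
proof -
  define T where "T = (\<Union>s\<in>S. theta_class s)"
  have S: "s \<in> carrier A" "finite (theta_class s)" if "s \<in> S" for s
    using tf[OF that] by (auto simp: theta_f_element_def)
  have T: "T \<subseteq> carrier A" using S theta_class_closed by (auto simp: T_def)
  have finT: "finite T" using fin S by (simp add: T_def)
  have conj: "g \<otimes>\<^bsub>A\<^esub> y \<otimes>\<^bsub>A\<^esub> inv\<^bsub>A\<^esub> g \<in> T" if "g \<in> carrier A" "y \<in> T" for g y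
    using that theta_class_conj S(1) unfolding T_def by blast
  have lam: "lam g y \<in> T" if "g \<in> carrier A" "y \<in> T" for g y
    using that theta_class_lam S(1) unfolding T_def by blast
  have ordT: "add.ord y \<noteq> 0" if "y \<in> T" for y
    using that theta_class_ord[OF S(1) ord] unfolding T_def by blast
  have "S \<subseteq> T" using S(1) self_in_theta_class by (auto simp: T_def)
  also have "T \<subseteq> generate A T" by (auto intro: generate.incl)
  finally have "strong_left_ideal_generated S \<subseteq> generate A T"
    using strong_left_ideal_generate[OF T finT conj lam] strong_left_ideal_generated_least
    by blast
  then show ?thesis using add.Dietzmann[OF T finT ordT conj] finite_subset by blast
qed

end

theorem theorem5p26:
  fixes A :: "('a, 'm) monoid_scheme" and C :: "('a, 'n) monoid_scheme"
    and n :: nat and x :: "nat \<Rightarrow> 'a"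
  assumes "skew_brace A C"
    and "\<And>i. i \<in> {1..n} \<Longrightarrow> skew_brace.theta_f_element A C (x i)"
    and "\<And>i. i \<in> {1..n} \<Longrightarrow> group.ord A (x i) \<noteq> 0"
  shows "finite (skew_brace.strong_left_ideal_generated A C (x ` {1..n}))"
proof -
  interpret skew_brace A C by (rule assms(1))
  show ?thesis
    using assms(2,3) by (intro finite_strong_left_ideal_generated) auto
qed

end
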